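(* Let $X$ be a weakly sober space and let $p:X\to X$ be a continuous map that is a kernel operator with respect to the specialization order of $X$. Then $p(X)$, with the subspace topology from $X$, is weakly sober.
   Context: For a topological space $X$, the specialization preorder is $x\le y$ iff $x\in\mathrm{cl}\{y\}$; all order-theoretic notions in $X$ refer to it (for a subspace, to the specialization preorder of the subspace, with bounds taken inside the subspace). For $A\subseteq X$, $A^{\uparrow}$ and $A^{\downarrow}$ denote the sets of all upper, respectively lower, bounds of $A$ in $X$, and $A^{\delta}=(A^{\uparrow})^{\downarrow}$ is the cut closure of $A$; $A$ is a cut if $A=A^{\delta}$. Irreducible closed sets are nonempty. $X$ is weakly sober if it is $T_0$ and every irreducible closed subset $A$ of $X$ is a cut, i.e. an intersection of point closures (the whole space being the empty intersection). A kernel operator is a monotone idempotent self-map $p$ (so $p\circ p=p$) with $p(x)\le x$ for all $x$. *)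

theory Defs
  imports "HOL-Analysis.Analysis"
begin

text \<open>All notions are relative to the points of a space \<open>X :: 'a topology\<close>; applied to
  \<open>subtopology X S\<close>, bounds and cuts are thus those computed inside the subspace.\<close>

definition specialization_le :: "'a topology \<Rightarrow> 'a \<Rightarrow> 'a \<Rightarrow> bool" where
  "specialization_le X x y \<longleftrightarrow> x \<in> X closure_of {y}"

definition upper_bounds_in :: "'a topology \<Rightarrow> 'a set \<Rightarrow> 'a set" where
  "upper_bounds_in X A = {u \<in> topspace X. \<forall>a\<in>A. specialization_le X a u}"

definition lower_bounds_in :: "'a topology \<Rightarrow> 'a set \<Rightarrow> 'a set" where
  "lower_bounds_in X A = {l \<in> topspace X. \<forall>a\<in>A. specialization_le X l a}"

text \<open>If \<open>A\<close> has no upper bound, its cut closure is all of \<open>topspace X\<close>.\<close>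

definition cut_closure :: "'a topology \<Rightarrow> 'a set \<Rightarrow> 'a set" where
  "cut_closure X A = lower_bounds_in X (upper_bounds_in X A)"

definition cut_in :: "'a topology \<Rightarrow> 'a set \<Rightarrow> bool" where
  "cut_in X A \<longleftrightarrow> A \<subseteq> topspace X \<and> A = cut_closure X A"

definition irreducible_closedin :: "'a topology \<Rightarrow> 'a set \<Rightarrow> bool" where
  "irreducible_closedin X A \<longleftrightarrow>
     closedin X A \<and> A \<noteq> {} \<and>
     (\<forall>B C. closedin X B \<and> closedin X C \<and> A \<subseteq> B \<union> C \<longrightarrow> A \<subseteq> B \<or> A \<subseteq> C)"

definition weakly_sober :: "'a topology \<Rightarrow> bool" where
  "weakly_sober X \<longleftrightarrow> t0_space X \<and> (\<forall>A. irreducible_closedin X A \<longrightarrow> cut_in X A)"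

definition specialization_kernel_operator :: "'a topology \<Rightarrow> ('a \<Rightarrow> 'a) \<Rightarrow> bool" where
  "specialization_kernel_operator X p \<longleftrightarrow>
     p ` topspace X \<subseteq> topspace X \<and>
     monotone_on (topspace X) (specialization_le X) (specialization_le X) p \<and>
     (\<forall>x\<in>topspace X. p (p x) = p x) \<and>
     (\<forall>x\<in>topspace X. specialization_le X (p x) x)"

end

theory Submission
  imports Defs
begin

text \<open>Let \<open>A\<close> be irreducible closed in \<open>p(X)\<close>. Its closure in \<open>X\<close> is irreducible, hence a cut, and it
  meets \<open>p(X)\<close> in \<open>A\<close>. If \<open>u\<close> is any upper bound of \<open>A\<close> in \<open>X\<close>, then \<open>p u\<close> is an upper bound of \<open>A\<close>
  lying in \<open>p(X)\<close>, since \<open>p\<close> is monotone and fixes \<open>A\<close>. So a point below all upper bounds of \<open>A\<close> in \<open>p(X)\<close>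
  is below \<open>p u \<le> u\<close> for all such \<open>u\<close>, and therefore lies in the cut.\<close>

text \<open>Closures in a subspace are traces of closures in \<open>X\<close>, so bounds computed
  inside the subspace can be compared in \<open>X\<close>.\<close>

lemma specialization_le_subtopology:
  assumes "x \<in> S" "y \<in> S"
  shows "specialization_le (subtopology X S) x y \<longleftrightarrow> specialization_le X x y"
  using assms by (simp add: specialization_le_def closure_of_subtopology)

lemma specialization_le_trans:
  assumes "specialization_le X x y" "specialization_le X y z"
  shows "specialization_le X x z"
proof -
  have "X closure_of {y} \<subseteq> X closure_of {z}"
    using assms(2) by (intro closure_of_minimal) (auto simp: specialization_le_def)
  with assms(1) show ?thesis
    by (auto simp: specialization_le_def)
qed

lemma subset_cut_closure: "A \<subseteq> topspace X \<Longrightarrow> A \<subseteq> cut_closure X A"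
  by (auto simp: cut_closure_def lower_bounds_in_def upper_bounds_in_def)

text \<open>A closed cover \<open>B\<close>, \<open>C\<close> of the closure restricts to a
  relatively closed cover of \<open>A\<close>. The piece that contains \<open>A\<close> is closed in
  \<open>X\<close>, so it contains the closure as well.\<close>

lemma irreducible_closedin_closure_of:
  assumes "irreducible_closedin (subtopology X S) A"
  shows "irreducible_closedin X (X closure_of A)"
  unfolding irreducible_closedin_def
proof (intro conjI allI impI)
  have A: "A \<subseteq> S" "A \<subseteq> topspace X" "A \<noteq> {}"
    using assms closedin_subset by (fastforce simp: irreducible_closedin_def)+
  then show "X closure_of A \<noteq> {}"
    using closure_of_subset by blast
  fix B C
  assume BC: "closedin X B \<and> closedin X C \<and> X closure_of A \<subseteq> B \<union> C"
  then have "A \<subseteq> (B \<inter> S) \<union> (C \<inter> S)"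
    using A closure_of_subset by blast
  moreover have "closedin (subtopology X S) (B \<inter> S)" "closedin (subtopology X S) (C \<inter> S)"
    using BC by (auto simp: closedin_subtopology)
  ultimately have "A \<subseteq> B \<inter> S \<or> A \<subseteq> C \<inter> S"
    using assms unfolding irreducible_closedin_def by blast
  then show "X closure_of A \<subseteq> B \<or> X closure_of A \<subseteq> C"
    using BC by (auto dest: closure_of_minimal)
qed simp

theorem proposition3p10:
  fixes X :: "'a topology" and p :: "'a \<Rightarrow> 'a"
  assumes "weakly_sober X"
    and "continuous_map X X p"
    and "specialization_kernel_operator X p"
  shows "weakly_sober (subtopology X (p ` topspace X))"
proof -
  define S where "S = p ` topspace X"
  have S: "S \<subseteq> topspace X"
    and mono: "\<And>x y. \<lbrakk>x \<in> topspace X; y \<in> topspace X; specialization_le X x y\<rbrakk>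
      \<Longrightarrow> specialization_le X (p x) (p y)"
    and fixed: "\<And>x. x \<in> S \<Longrightarrow> p x = x"
    and below: "\<And>x. x \<in> topspace X \<Longrightarrow> specialization_le X (p x) x"
    using assms(3) by (auto simp: S_def specialization_kernel_operator_def monotone_on_def)
  have "cut_in (subtopology X S) A" if irr: "irreducible_closedin (subtopology X S) A" for A
  proof -
    have closed: "closedin (subtopology X S) A"
      using irr by (simp add: irreducible_closedin_def)
    then have A: "A \<subseteq> S" "A \<subseteq> topspace X"
      using closedin_subset by fastforce+
    \<comment> \<open>The left side is the closure of \<open>A\<close> in the subspace, where
      \<open>A\<close> is already closed.\<close>
    have trace: "S \<inter> X closure_of A = A"
      using closure_of_closedin[OF closed] A
      by (simp add: closure_of_subtopology Int_absorb1)
    have cut: "X closure_of A = cut_closure X (X closure_of A)"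
      using irreducible_closedin_closure_of[OF irr] assms(1)
      by (simp add: weakly_sober_def cut_in_def)
    have "y \<in> A" if y: "y \<in> cut_closure (subtopology X S) A" for y
    proof -
      have yS: "y \<in> S"
        using y by (simp add: cut_closure_def lower_bounds_in_def)
      have "specialization_le X y u" if u: "u \<in> upper_bounds_in X (X closure_of A)" for u
      proof -
        \<comment> \<open>Bounding the closure, \<open>u\<close> bounds its subset
          \<open>A\<close>.\<close>
        have uX: "u \<in> topspace X" and ub: "\<And>a. a \<in> A \<Longrightarrow> specialization_le X a u"
          using u closure_of_subset[OF A(2)] by (auto simp: upper_bounds_in_def)
        have pu: "p u \<in> S"
          using uX by (simp add: S_def)
        have "specialization_le X a (p u)" if "a \<in> A" for a
          using mono[of a u] ub[of a] fixed[of a] that A uX by (metis subsetD)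
        then have "p u \<in> upper_bounds_in (subtopology X S) A"
          using pu S A by (auto simp: upper_bounds_in_def specialization_le_subtopology)
        then have "specialization_le X y (p u)"
          using y yS pu
          by (auto simp: cut_closure_def lower_bounds_in_def specialization_le_subtopology)
        then show ?thesis
          using below[OF uX] by (rule specialization_le_trans)
      qed
      \<comment> \<open>Rewriting the closure by \<open>cut\<close> turns membership into being a
        point of \<open>X\<close> below every such \<open>u\<close>.\<close>
      then have "y \<in> X closure_of A"
        using yS S by (subst cut) (auto simp: cut_closure_def lower_bounds_in_def)
      with yS trace show ?thesis
        by blast
    qed
    \<comment> \<open>Only this inclusion depended on \<open>p\<close>; every set of points lies in
      its cut closure.\<close>
    then show ?thesis
      using A subset_cut_closure[of A "subtopology X S"] by (auto simp: cut_in_def)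
  qed
  moreover have "t0_space (subtopology X S)"
    using assms(1) by (simp add: weakly_sober_def t0_space_subtopology)
  ultimately show ?thesis
    by (simp add: weakly_sober_def S_def)
qed

end
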